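(* Let $n>s\geq 1$ be integers with $\gcd(n,s)=1$, let $a,b\in\mathbb{Z}$ be not both zero, let $g(t)=t^n-1$ and $$f(t)=b\sum_{i=0}^{s-1}t^i+a\sum_{i=s}^{n-1}t^i.$$ Define $k:=\frac{|a(n-s)+sb|}{\gcd(a,b)}$. Then the invariant factors of $f(C_g)$ are $$\gcd(a,b),\ \underbrace{|a-b|,\dots,|a-b|}_{n-2\ \text{times}},\ k\cdot|a-b|.$$
   Context: For a monic polynomial $g(t)=t^n+\sum_{i=0}^{n-1}g_it^i\in\mathbb{Z}[t]$, the companion matrix $C_g\in\mathbb{Z}^{n\times n}$ has first row $(-g_{n-1},\dots,-g_1,-g_0)$, entries $1$ in positions $(i+1,i)$ for $1\le i\le n-1$, and $0$ elsewhere; for $g(t)=t^n-1$ it is a cyclic permutation matrix and $f(C_g)$ is a circulant matrix. For $f(t)=\sum_i f_it^i$, $f(C_g)=\sum_i f_iC_g^i$. The invariant factors of an $n\times n$ integer matrix $M$ are the $n$ non-negative diagonal entries $s_1\mid s_2\mid\dots\mid s_n$ (zeros allowed) of its Smith form, i.e. of the diagonal matrix $UMV$ with $U,V$ invertible over $\mathbb{Z}$. *)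

theory Defs
  imports Jordan_Normal_Form.Matrix "HOL-Computational_Algebra.Polynomial"
begin

(* Rows and columns are indexed from 0, so the first row is
   (- g_(n-1), ..., - g_1, - g_0) and the ones sit on the subdiagonal.
   Meaningful for monic g. *)
definition companion_mat :: "int poly \<Rightarrow> int mat" where
  "companion_mat g =
     (let n = degree g in
      mat n n (\<lambda>(i, j). if i = 0 then - coeff g (n - 1 - j)
                        else if i = j + 1 then 1 else 0))"

(* Meaningful for square A. Matrices of all sizes share one type, so the sum is
   taken in the ring of matrices of the size of A. *)
definition poly_mat :: "int poly \<Rightarrow> int mat \<Rightarrow> int mat" where
  "poly_mat f A =
     finsum (ring_mat TYPE(int) (dim_row A) ()) (\<lambda>i. coeff f i \<cdot>\<^sub>m (A ^\<^sub>m i)) {..degree f}"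

(* Since U and V are integer matrices, invertible_mat means invertibility over the integers. *)
definition is_smith_form :: "int mat \<Rightarrow> int mat \<Rightarrow> bool" where
  "is_smith_form M S \<longleftrightarrow>
     (\<exists>n U V. M \<in> carrier_mat n n \<and> U \<in> carrier_mat n n \<and> V \<in> carrier_mat n n
        \<and> invertible_mat U \<and> invertible_mat V \<and> S = U * M * V)
     \<and> diagonal_mat S
     \<and> (\<forall>i < dim_row S. 0 \<le> S $$ (i, i))
     \<and> (\<forall>i. i + 1 < dim_row S \<longrightarrow> S $$ (i, i) dvd S $$ (i + 1, i + 1))"

definition are_invariant_factors :: "int mat \<Rightarrow> int list \<Rightarrow> bool" where
  "are_invariant_factors M ds \<longleftrightarrow> (\<exists>S. is_smith_form M S \<and> ds = diag_mat S)"

end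

(* Put d = b - a, let J be the all-ones matrix and S the circulant matrix of h = 1 + t + ... + t^(s-1),
   so that f(C_g) = d S + a J. Choose s u = q n + 1. Then 1 + t^s + ... + t^(s(u-1)) inverts h modulo
   1 + t + ... + t^(n-1), and correcting its circulant matrix by a rank one matrix gives a unimodular V
   with f(C_g) V = d I + 1 z^T for an explicit z. In a basis starting with the all-ones vector, whose
   other members are annihilated by z except for the last, this becomes d I with the first and last
   coordinates replaced by the block [[n a + s d, u a + q d], [0, d]]. The top row of this block is
   (a, d) times the unimodular matrix [[n, u], [s, q]], so the block is equivalent to
   [[a, d], [n a + s d, 0]], which a Bezout identity for gcd(a, d) = gcd(a, b) diagonalizes. *)

theory Submission
  imports Defs Jordan_Normal_Form.Determinant
begin

section \<open>Unimodular matrices\<close>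

text \<open>The determinants of \<open>A\<close> and \<open>B\<close> are mutually inverse, so
  \<open>det B\<close> times the adjugate of \<open>A\<close> is a left inverse of \<open>A\<close>,
  which must coincide with the right inverse \<open>B\<close>.\<close>

lemma invertible_matI_right_inverse:
  fixes A :: "'a :: comm_ring_1 mat"
  assumes A: "A \<in> carrier_mat n n" and B: "B \<in> carrier_mat n n" and AB: "A * B = 1\<^sub>m n"
  shows "invertible_mat A" and "invertible_mat B"
proof -
  define C where "C = det B \<cdot>\<^sub>m adj_mat A"
  have C: "C \<in> carrier_mat n n"
    using adj_mat(1)[OF A] by (simp add: C_def)
  have "det A * det B = 1"
    using det_mult[OF A B] AB by simp
  moreover have "C * A = det B \<cdot>\<^sub>m (det A \<cdot>\<^sub>m 1\<^sub>m n)"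
    unfolding C_def using mult_smult_assoc_mat[OF adj_mat(1)[OF A] A] adj_mat(3)[OF A] by simp
  ultimately have CA: "C * A = 1\<^sub>m n"
    by (auto simp: mult.commute intro!: eq_matI)
  have "C = C * (A * B)"
    using C AB by simp
  also have "\<dots> = B"
    using CA assoc_mult_mat[OF C A B] B by simp
  finally have "B * A = 1\<^sub>m n"
    using CA by simp
  then show "invertible_mat A" "invertible_mat B"
    using A B AB unfolding invertible_mat_def inverts_mat_def by auto
qed

lemma invertible_mat_mult:
  fixes A :: "'a :: comm_ring_1 mat"
  assumes A: "A \<in> carrier_mat n n" and B: "B \<in> carrier_mat n n"
    and "invertible_mat A" and "invertible_mat B"
  shows "invertible_mat (A * B)"
proof -
  obtain A' where A': "A * A' = 1\<^sub>m n" "A' * A = 1\<^sub>m (dim_row A')"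
    using assms unfolding invertible_mat_def inverts_mat_def by auto
  obtain B' where B': "B * B' = 1\<^sub>m n" "B' * B = 1\<^sub>m (dim_row B')"
    using assms unfolding invertible_mat_def inverts_mat_def by auto
  \<comment> \<open>The shape of an inverse is not part of \<open>invertible_mat\<close>; it is read
    off from the column dimensions of the two products.\<close>
  have cA: "A' \<in> carrier_mat n n"
    using arg_cong[OF A'(1), of dim_col] arg_cong[OF A'(2), of dim_col] A by auto
  have cB: "B' \<in> carrier_mat n n"
    using arg_cong[OF B'(1), of dim_col] arg_cong[OF B'(2), of dim_col] B by auto
  have "A * B * (B' * A') = A * (B * B') * A'"
    using A B cA cB by (simp add: assoc_mult_mat[of _ n n _ n _ n])
  also have "\<dots> = 1\<^sub>m n"
    using A A' B' by simp
  finally show ?thesis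
    using invertible_matI_right_inverse[of "A * B" n "B' * A'"] A B cA cB by simp
qed

lemma mat_times_mat:
  fixes F G :: "nat \<times> nat \<Rightarrow> 'a :: semiring_0"
  shows "mat n m F * mat m l G = mat n l (\<lambda>(i, j). \<Sum>k<m. F (i, k) * G (k, j))"
  by (rule eq_matI) (auto simp: scalar_prod_def lessThan_atLeast0 intro!: sum.cong)

section \<open>Block matrices with a scalar middle block\<close>

text \<open>Up to the order of the coordinates, a direct sum of a 2x2 block on the first and last
  coordinates and a scalar on the others. The shape is closed under products, which reduces the
  diagonalization to 2x2 matrices.\<close>

definition corner_mat :: "nat \<Rightarrow> 'a :: comm_ring_1 \<Rightarrow> 'a \<Rightarrow> 'a \<Rightarrow> 'a \<Rightarrow> 'a \<Rightarrow> 'a mat" where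
  "corner_mat n x p q r t = mat n n (\<lambda>(i, j).
     if i = 0 then (if j = 0 then p else if j = n - 1 then q else 0)
     else if i = n - 1 then (if j = 0 then r else if j = n - 1 then t else 0)
     else if i = j then x else 0)"

lemma corner_mat_carrier [simp]: "corner_mat n x p q r t \<in> carrier_mat n n"
  by (simp add: corner_mat_def)

lemma mat_times_corner_mat:
  assumes n: "2 \<le> n"
  shows "mat n n F * corner_mat n x p q r t = mat n n (\<lambda>(i, j).
     if j = 0 then F (i, 0) * p + F (i, n - 1) * r
     else if j = n - 1 then F (i, 0) * q + F (i, n - 1) * t
     else F (i, j) * x)"
proof -
  define G where "G k j = (if k = 0 then (if j = 0 then p else if j = n - 1 then q else 0)
     else if k = n - 1 then (if j = 0 then r else if j = n - 1 then t else 0)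
     else if k = j then x else 0)" for k j
  have ends: "(\<Sum>k<n. F (i, k) * G k j) = F (i, 0) * G 0 j + F (i, n - 1) * G (n - 1) j"
    if "j = 0 \<or> j = n - 1" for i j
  proof -
    have "(\<Sum>k<n. F (i, k) * G k j) = (\<Sum>k\<in>{0, n - 1}. F (i, k) * G k j)"
      using n that by (intro sum.mono_neutral_right) (auto simp: G_def)
    then show ?thesis
      using n by simp
  qed
  have middle: "(\<Sum>k<n. F (i, k) * G k j) = F (i, j) * x"
    if "j < n" "j \<noteq> 0" "j \<noteq> n - 1" for i j
  proof -
    have "(\<Sum>k<n. F (i, k) * G k j) = (\<Sum>k\<in>{j}. F (i, k) * G k j)"
      using that by (intro sum.mono_neutral_right) (auto simp: G_def)
    then show ?thesis
      using that by (simp add: G_def)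
  qed
  have "corner_mat n x p q r t = mat n n (\<lambda>(k, j). G k j)"
    by (simp add: corner_mat_def G_def)
  then have "mat n n F * corner_mat n x p q r t = mat n n (\<lambda>(i, j). \<Sum>k<n. F (i, k) * G k j)"
    by (simp add: mat_times_mat)
  also have "\<dots> = mat n n (\<lambda>(i, j).
     if j = 0 then F (i, 0) * G 0 0 + F (i, n - 1) * G (n - 1) 0
     else if j = n - 1 then F (i, 0) * G 0 (n - 1) + F (i, n - 1) * G (n - 1) (n - 1)
     else F (i, j) * x)"
    by (rule eq_matI) (auto simp: ends middle)
  moreover have "G 0 0 = p" "G (n - 1) 0 = r" "G 0 (n - 1) = q" "G (n - 1) (n - 1) = t"
    using n by (simp_all add: G_def)
  ultimately show ?thesis
    by (simp only:)
qed

lemma corner_mat_mult: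
  assumes "2 \<le> n"
  shows "corner_mat n x p q r t * corner_mat n x' p' q' r' t' =
    corner_mat n (x * x') (p * p' + q * r') (p * q' + q * t') (r * p' + t * r') (r * q' + t * t')"
  by (subst (1) corner_mat_def, subst mat_times_corner_mat[OF assms])
     (use assms in \<open>auto simp: corner_mat_def intro!: eq_matI\<close>)

lemma corner_mat_one: "2 \<le> n \<Longrightarrow> corner_mat n 1 1 0 0 1 = 1\<^sub>m n"
  by (auto simp: corner_mat_def intro!: eq_matI)

text \<open>The determinant of the block is its own inverse, so multiplying the adjugate by it
  inverts the block; \<open>x\<close> inverts itself.\<close>

lemma invertible_corner_mat:
  fixes x :: "'a :: comm_ring_1"
  assumes n: "2 \<le> n" and x: "x * x = 1" and e: "(p * t - q * r) * (p * t - q * r) = 1"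
  shows "invertible_mat (corner_mat n x p q r t)"
proof -
  define e where "e = p * t - q * r"
  have "e * e = 1"
    using e by (simp add: e_def)
  then have "p * (e * t) + q * (- e * r) = 1" "r * (- e * q) + t * (e * p) = 1"
    "p * (- e * q) + q * (e * p) = 0" "r * (e * t) + t * (- e * r) = 0"
    by (simp_all add: e_def algebra_simps)
  then have "corner_mat n x p q r t * corner_mat n x (e * t) (- e * q) (- e * r) (e * p) = 1\<^sub>m n"
    by (simp only: corner_mat_mult[OF n] x corner_mat_one[OF n])
  then show ?thesis
    by (rule invertible_matI_right_inverse(1)[rotated 2]) simp_all
qed

section \<open>Counting residues\<close>

text \<open>The coefficient of t^x in 1 + t + ... + t^(m-1) modulo t^n - 1. The index
  \<open>x\<close> is an integer so that differences of row and column indices can be inserted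
  directly.\<close>

definition residue_count :: "nat \<Rightarrow> int \<Rightarrow> nat \<Rightarrow> int" where
  "residue_count n x m = (\<Sum>r<m. of_bool (int n dvd x - int r))"

lemma dvd_diff_iff_eq_nat_mod:
  assumes "0 < n" and "k < n"
  shows "int n dvd x - int k \<longleftrightarrow> k = nat (x mod int n)"
  using assms by (auto simp: mod_eq_dvd_iff[symmetric] nat_eq_iff)

text \<open>Exactly one k below n is congruent to x. This sifting property evaluates the cyclic
  convolutions below.\<close>

lemma sum_of_bool_dvd_diff:
  fixes F :: "nat \<Rightarrow> int"
  assumes "0 < n"
  shows "(\<Sum>k<n. of_bool (int n dvd x - int k) * F k) = F (nat (x mod int n))"
proof -
  have "(\<Sum>k<n. of_bool (int n dvd x - int k) * F k) = (\<Sum>k<n. if k = nat (x mod int n) then F k else 0)"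
    using assms by (intro sum.cong) (auto simp: dvd_diff_iff_eq_nat_mod)
  also have "\<dots> = F (nat (x mod int n))"
    using assms by (simp add: nat_less_iff)
  finally show ?thesis .
qed

lemma sum_of_bool_dvd_diff':
  fixes F :: "nat \<Rightarrow> int"
  assumes "0 < n"
  shows "(\<Sum>k<n. of_bool (int n dvd int k - x) * F k) = F (nat (x mod int n))"
  using sum_of_bool_dvd_diff[OF assms, of x F] by (simp add: dvd_diff_commute)

lemma residue_count_period: "0 < n \<Longrightarrow> residue_count n x n = 1"
  using sum_of_bool_dvd_diff[of n x "\<lambda>_. 1"] by (simp add: residue_count_def)

lemma residue_count_cong:
  assumes "int n dvd x - y"
  shows "residue_count n x m = residue_count n y m"
proof -
  have "int n dvd x - int r \<longleftrightarrow> int n dvd y - int r" for r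
    using dvd_add_right_iff[OF assms, of "y - int r"] by simp
  then show ?thesis by (simp add: residue_count_def)
qed

lemma residue_count_eq_of_bool:
  assumes "0 < n" and "m \<le> n"
  shows "residue_count n x m = of_bool (nat (x mod int n) < m)"
proof -
  have "residue_count n x m = (\<Sum>r<m. if r = nat (x mod int n) then 1 else 0)"
    unfolding residue_count_def
    using assms by (intro sum.cong) (auto simp: dvd_diff_iff_eq_nat_mod)
  then show ?thesis by simp
qed

lemma residue_count_add:
  "residue_count n x (l + m) = residue_count n x l + residue_count n (x - int l) m"
  by (induction m) (simp_all add: residue_count_def algebra_simps)

text \<open>The su exponents split into u blocks of length s, block l being the first one shifted by
  sl.\<close>

lemma residue_count_mult:
  "residue_count n x (s * u) = (\<Sum>l<u. residue_count n (x - int (s * l)) s)"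
  by (induction u) (simp_all add: residue_count_add add.commute[of s] , simp add: residue_count_def)

text \<open>The q full periods meet each residue class q times, and the one remaining exponent qn is
  congruent to 0.\<close>

lemma residue_count_period_mult_Suc:
  assumes "0 < n"
  shows "residue_count n x (q * n + 1) = int q + of_bool (int n dvd x)"
proof -
  have "residue_count n x (n * q) = int q"
    using assms by (simp add: residue_count_mult residue_count_period)
  then have "residue_count n x (q * n + 1) = int q + residue_count n (x - int (q * n)) 1"
    by (simp only: residue_count_add mult.commute[of q n])
  also have "residue_count n (x - int (q * n)) 1 = residue_count n x 1"
    by (rule residue_count_cong) simp
  finally show ?thesis by (simp add: residue_count_def)
qed

lemma sum_residue_count:
  assumes "0 < n"
  shows "(\<Sum>k<n. residue_count n (x - int k) s) = int s"
proof -
  have "(\<Sum>k<n. residue_count n (x - int k) s)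
      = (\<Sum>r<s. \<Sum>k<n. of_bool (int n dvd (x - int r) - int k))"
    unfolding residue_count_def by (subst sum.swap) (simp add: algebra_simps)
  also have "\<dots> = int s"
    using sum_of_bool_dvd_diff[OF assms, of _ "\<lambda>_. 1"] by simp
  finally show ?thesis .
qed

text \<open>The coefficient of t^x in 1 + t^s + ... + t^(s(u-1)) modulo t^n - 1.\<close>

definition stride_count :: "nat \<Rightarrow> nat \<Rightarrow> nat \<Rightarrow> int \<Rightarrow> int" where
  "stride_count n s u x = (\<Sum>l<u. of_bool (int n dvd x - int (s * l)))"

lemma sum_stride_count:
  assumes "0 < n"
  shows "(\<Sum>k<n. stride_count n s u (int k - x)) = int u"
proof -
  have "(\<Sum>k<n. stride_count n s u (int k - x))
      = (\<Sum>l<u. \<Sum>k<n. of_bool (int n dvd int k - (x + int (s * l))))"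
    unfolding stride_count_def by (subst sum.swap) (simp add: algebra_simps)
  also have "\<dots> = int u"
    using sum_of_bool_dvd_diff'[OF assms, of _ "\<lambda>_. 1"] by simp
  finally show ?thesis .
qed

text \<open>In \<open>\<int>[t]/(t\<^sup>n - 1)\<close> this is
  \<open>(1 + t + \<dots> + t^(s-1)) (1 + t^s + \<dots> + t^(s(u-1))) = 1 + t + \<dots> + t^(su-1)\<close>.\<close>

lemma residue_count_stride_count_convolution:
  assumes "0 < n"
  shows "(\<Sum>k<n. residue_count n (x - int k) s * stride_count n s u (int k - y))
    = residue_count n (x - y) (s * u)"
proof -
  have "(\<Sum>k<n. residue_count n (x - int k) s * stride_count n s u (int k - y))
      = (\<Sum>l<u. \<Sum>k<n. of_bool (int n dvd int k - (y + int (s * l))) * residue_count n (x - int k) s)"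
    unfolding stride_count_def sum_distrib_left
    by (subst sum.swap) (simp add: algebra_simps)
  also have "\<dots> = (\<Sum>l<u. residue_count n (x - y - int (s * l)) s)"
  proof (intro sum.cong refl)
    fix l
    let ?z = "y + int (s * l)"
    have "(\<Sum>k<n. of_bool (int n dvd int k - ?z) * residue_count n (x - int k) s)
        = residue_count n (x - ?z mod int n) s"
      using assms by (subst sum_of_bool_dvd_diff') simp_all
    also have "\<dots> = residue_count n (x - y - int (s * l)) s"
    proof (rule residue_count_cong)
      have "x - ?z mod int n - (x - y - int (s * l)) = ?z - ?z mod int n" by simp
      then show "int n dvd x - ?z mod int n - (x - y - int (s * l))"
        by (metis dvd_minus_mod)
    qed
    finally show "(\<Sum>k<n. of_bool (int n dvd int k - ?z) * residue_count n (x - int k) s)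
        = residue_count n (x - y - int (s * l)) s" .
  qed
  also have "\<dots> = residue_count n (x - y) (s * u)"
    by (simp add: residue_count_mult)
  finally show ?thesis .
qed

lemma int_dvd_diff_less_iff:
  assumes "i < n" and "j < n"
  shows "int n dvd int i - int j \<longleftrightarrow> i = j"
  using assms dvd_diff_iff_eq_nat_mod[of n j "int i"] by auto

section \<open>Polynomials in the cyclic permutation matrix\<close>

lemma companion_mat_cyclic:
  assumes "2 \<le> n"
  shows "companion_mat (monom 1 n - 1) = mat n n (\<lambda>(i, j). of_bool (int n dvd int i - int j - 1))"
proof -
  have deg: "degree (monom 1 n - 1 :: int poly) = n"
    using assms degree_add_eq_left[of "- 1" "monom (1 :: int) n"] by (simp add: degree_monom_eq)
  show ?thesis
    unfolding companion_mat_def Let_def deg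
  proof (rule eq_matI, goal_cases)
    case (1 i j)
    then have ij: "i < n" "j < n" by auto
    show ?case
    proof (cases "i = 0")
      case True
      \<comment> \<open>In row 0 the congruence wraps around only at the last column, where the
        constant coefficient -1 of t^n - 1 yields the entry 1.\<close>
      have "int n dvd - int j - 1 \<longleftrightarrow> n dvd j + 1"
        by (metis (no_types, opaque_lifting) diff_conv_add_uminus dvd_minus_iff int_dvd_int_iff minus_add_distrib of_nat_1 of_nat_add)
      also have "\<dots> \<longleftrightarrow> j = n - 1"
        using ij by (auto dest: dvd_imp_le)
      finally show ?thesis
        using True ij assms by (auto simp: coeff_monom)
    next
      case False
      have "int n dvd int i - int j - 1 \<longleftrightarrow> i = j + 1"
      proof (cases "j + 1 < n")
        case True
        then show ?thesis
          using int_dvd_diff_less_iff[of i n "j + 1"] ij by (simp add: algebra_simps)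
      next
        case False
        then have "int i - int j - 1 = int i - int n" using ij by simp
        moreover have "\<not> int n dvd int i - int n"
          using ij \<open>i \<noteq> 0\<close> dvd_add_right_iff[of "int n" "int n" "int i - int n"]
          by (auto dest: dvd_imp_le)
        ultimately show ?thesis using ij False by (simp only:) simp
      qed
      with False ij show ?thesis by simp
    qed
  qed auto
qed

lemma cyclic_mat_power:
  assumes "0 < n"
  shows "mat n n (\<lambda>(i, j). of_bool (int n dvd int i - int j - 1)) ^\<^sub>m m
    = (mat n n (\<lambda>(i, j). of_bool (int n dvd int i - int j - int m)) :: int mat)"
proof (induction m)
  case 0
  then show ?case
    by (auto simp: int_dvd_diff_less_iff intro!: eq_matI)
next
  case (Suc m)
  have "(\<Sum>k<n. of_bool (int n dvd int i - int k - int m) * of_bool (int n dvd int k - int j - 1))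
      = (of_bool (int n dvd int i - int j - int (Suc m)) :: int)" for i j
  proof -
    let ?z = "int j + 1"
    have "(\<Sum>k<n. of_bool (int n dvd int i - int k - int m) * of_bool (int n dvd int k - int j - 1))
        = (\<Sum>k<n. of_bool (int n dvd int k - ?z) * (of_bool (int n dvd int i - int k - int m) :: int))"
      by (simp add: algebra_simps)
    also have "\<dots> = of_bool (int n dvd int i - ?z mod int n - int m)"
      using assms by (subst sum_of_bool_dvd_diff') simp_all
    also have "int n dvd int i - ?z mod int n - int m \<longleftrightarrow> int n dvd int i - int j - int (Suc m)"
    proof -
      have "int i - ?z mod int n - int m = (?z - ?z mod int n) + (int i - int j - int (Suc m))" by simp
      then show ?thesis
        by (metis dvd_add_right_iff dvd_minus_mod)
    qed
    finally show ?thesis .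
  qed
  then show ?case
    by (simp add: Suc.IH mat_times_mat)
qed

text \<open>Turns the ring sum in the definition of \<open>poly_mat\<close> into entrywise
  sums.\<close>

lemma finsum_ring_mat:
  assumes "finite I" and "\<And>i. i \<in> I \<Longrightarrow> F i \<in> carrier_mat n n"
  shows "finsum (ring_mat TYPE('a :: comm_ring_1) n b) F I = mat n n (\<lambda>ij. \<Sum>i\<in>I. F i $$ ij)"
proof -
  interpret R: ring "ring_mat TYPE('a) n b" by (rule ring_mat)
  show ?thesis
    using assms
  proof (induction I rule: finite_induct)
    case empty
    then show ?case by (auto simp: ring_mat_simps intro!: eq_matI)
  next
    case (insert i I)
    then have "finsum (ring_mat TYPE('a) n b) F (insert i I) = F i + finsum (ring_mat TYPE('a) n b) F I"
      by (subst R.finsum_insert) (auto simp: ring_mat_simps)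
    with insert show ?case by (auto intro!: eq_matI)
  qed
qed

lemma poly_mat_cyclic:
  assumes n: "2 \<le> n" and f: "\<And>m. n \<le> m \<Longrightarrow> coeff f m = 0"
  shows "poly_mat f (companion_mat (monom 1 n - 1))
    = mat n n (\<lambda>(i, j). coeff f (nat ((int i - int j) mod int n)))"
proof -
  have entry: "(\<Sum>m\<le>degree f. coeff f m * of_bool (int n dvd x - int m))
      = coeff f (nat (x mod int n))" for x
  proof -
    have "(\<Sum>m\<le>degree f. coeff f m * of_bool (int n dvd x - int m))
        = (\<Sum>m<n. coeff f m * of_bool (int n dvd x - int m))"
      using f by (intro sum.mono_neutral_cong) (auto simp: coeff_eq_0 not_le not_less)
    also have "\<dots> = coeff f (nat (x mod int n))"
      using n sum_of_bool_dvd_diff[of n x "coeff f"] by (simp add: mult.commute)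
    finally show ?thesis .
  qed
  show ?thesis
    unfolding poly_mat_def companion_mat_cyclic[OF n]
    using n entry by (auto simp: finsum_ring_mat cyclic_mat_power intro!: eq_matI)
qed

text \<open>This is f = (b - a)(1 + ... + t^(s-1)) + a(1 + ... + t^(n-1)) read entrywise: as s < n,
  each residue is counted at most once, so an entry is b or a.\<close>

lemma poly_mat_two_coefficients:
  fixes a b :: int
  assumes s: "1 \<le> s" "s < n"
  defines "f \<equiv> smult b (\<Sum>i = 0..<s. monom 1 i) + smult a (\<Sum>i = s..<n. monom 1 i)"
  shows "poly_mat f (companion_mat (monom 1 n - 1))
    = mat n n (\<lambda>(i, j). (b - a) * residue_count n (int i - int j) s + a)"
proof -
  have coeff: "coeff f m = (if m < s then b else if m < n then a else 0)" for m
    using s by (auto simp: f_def coeff_sum coeff_monom)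
  have "nat (x mod int n) < n" for x
    using s by (simp add: nat_less_iff)
  then show ?thesis
    using s by (subst poly_mat_cyclic) (auto simp: coeff residue_count_eq_of_bool intro!: eq_matI)
qed

section \<open>Inverting the geometric sum modulo the all-ones matrix\<close>

lemma affine_convolution:
  assumes n: "0 < n" and su: "s * u = q * n + 1"
  shows "(\<Sum>k<n. (c * residue_count n (x - int k) s + e) * (stride_count n s u (int k - y) + w))
    = c * (int q + of_bool (int n dvd x - y)) + e * int u + w * (c * int s + int n * e)"
proof -
  have "(\<Sum>k<n. (c * residue_count n (x - int k) s + e) * (stride_count n s u (int k - y) + w))
      = c * (\<Sum>k<n. residue_count n (x - int k) s * stride_count n s u (int k - y))
        + e * (\<Sum>k<n. stride_count n s u (int k - y))
        + w * c * (\<Sum>k<n. residue_count n (x - int k) s) + int n * (e * w)"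
    by (simp add: sum_distrib_left sum.distrib algebra_simps)
  then show ?thesis
    unfolding residue_count_stride_count_convolution[OF n] su residue_count_period_mult_Suc[OF n]
      sum_stride_count[OF n] sum_residue_count[OF n]
    by (simp add: algebra_simps)
qed

text \<open>The circulant matrix of \<^term>\<open>stride_count n s u\<close> maps the all-ones vector to \<open>u\<close> times itself
  and is invertible modulo it; the correction of the first column replaces the factor \<open>u\<close> by \<open>1\<close>.\<close>

definition stride_mat :: "nat \<Rightarrow> nat \<Rightarrow> nat \<Rightarrow> int mat" where
  "stride_mat n s u = mat n n (\<lambda>(k, j). stride_count n s u (int k - int j) + (1 - int u) * of_bool (j = 0))"

lemma invertible_stride_mat:
  assumes n: "0 < n" and su: "s * u = q * n + 1"
  shows "invertible_mat (stride_mat n s u)"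
proof -
  \<comment> \<open>With S the circulant of \<open>residue_count\<close> and J the all-ones matrix,
    S - qJ inverts the circulant of \<open>stride_count\<close> up to q(1-u)J. Subtracting (1-u)
    times row 0 of S from every row removes that error.\<close>
  define V' where "V' = mat n n (\<lambda>(i, k). residue_count n (int i - int k) s - int q
      - (1 - int u) * residue_count n (0 - int k) s)"
  have su': "int u * int s = int q * int n + 1"
    using arg_cong[OF su, of int] by (simp add: mult.commute)
  have "V' * stride_mat n s u = 1\<^sub>m n"
    unfolding V'_def stride_mat_def mat_times_mat
  proof (rule eq_matI, goal_cases)
    case (1 i j)
    then have ij: "i < n" "j < n" by auto
    define w where "w = (1 - int u) * of_bool (j = 0)"
    have "(\<Sum>k<n. (residue_count n (int i - int k) s - int q - (1 - int u) * residue_count n (0 - int k) s)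
          * (stride_count n s u (int k - int j) + w))
        = (\<Sum>k<n. (1 * residue_count n (int i - int k) s + - int q) * (stride_count n s u (int k - int j) + w))
        - (1 - int u) * (\<Sum>k<n. (1 * residue_count n (0 - int k) s + 0) * (stride_count n s u (int k - int j) + w))"
      by (simp add: sum_distrib_left sum_subtractf[symmetric] algebra_simps)
    also have "\<dots> = of_bool (int n dvd int i - int j) + int q * (1 - int u) + w * (int s - int n * int q)
        - (1 - int u) * (int q + of_bool (int n dvd int 0 - int j) + w * int s)"
      unfolding affine_convolution[OF n su] by (simp add: algebra_simps)
    \<comment> \<open>The terms q(1-u) cancel, and the indicator of j = 0 merges into
      \<open>w\<close>. What multiplies \<open>w\<close> is us - qn - 1 = 0.\<close>
    also have "\<dots> = of_bool (i = j) + w * (int s - int n * int q - 1 - (1 - int u) * int s)"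
      using int_dvd_diff_less_iff[OF ij] int_dvd_diff_less_iff[OF n ij(2)]
      by (simp add: w_def algebra_simps)
    also have "\<dots> = of_bool (i = j)"
      using su' by (simp add: algebra_simps)
    finally show ?case
      using ij by (simp add: w_def)
  qed auto
  then show ?thesis
    by (rule invertible_matI_right_inverse(2)[rotated 2]) (simp_all add: V'_def stride_mat_def)
qed

section \<open>Change of basis adapted to the all-ones vector\<close>

text \<open>The columns are the all-ones vector, the differences e_j - e_(n-1) for 0 < j < n-1, and
  e_(n-1). The differences have coordinate sum and first coordinate zero.\<close>

definition ones_basis_mat :: "nat \<Rightarrow> int mat" where
  "ones_basis_mat n = mat n n (\<lambda>(i, j).
     if j = 0 then 1 else if i = j then 1 else if i = n - 1 then - 1 else 0)"

lemma column_sum_ones_basis_mat: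
  assumes n: "2 \<le> n" and j: "j < n"
  shows "(\<Sum>k<n. ones_basis_mat n $$ (k, j)) = (if j = 0 then int n else of_bool (j = n - 1))"
proof (cases "j = 0 \<or> j = n - 1")
  case True
  have "(\<Sum>k<n. ones_basis_mat n $$ (k, j)) = (\<Sum>k<n. if j = 0 then 1 else of_bool (k = n - 1))"
    using True j by (intro sum.cong) (auto simp: ones_basis_mat_def)
  then show ?thesis
    using n True by (auto simp: of_bool_def)
next
  case False
  have "(\<Sum>k<n. ones_basis_mat n $$ (k, j)) = (\<Sum>k\<in>{j, n - 1}. ones_basis_mat n $$ (k, j))"
    using False j n by (intro sum.mono_neutral_right) (auto simp: ones_basis_mat_def)
  then show ?thesis
    using False j by (simp add: ones_basis_mat_def)
qed

lemma ones_basis_mat_left_inverse: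
  assumes n: "2 \<le> n"
  obtains L where "L \<in> carrier_mat n n" and "L * ones_basis_mat n = 1\<^sub>m n"
proof
  \<comment> \<open>The rows give the coordinates of a vector v in this basis: v_0, then v_i - v_0,
    and finally the sum of all v_k minus n v_0.\<close>
  let ?L = "mat n n (\<lambda>(i, k). of_bool (i = n - 1 \<or> i = k)
      - of_bool (k = 0) * (if i = 0 then 0 else if i = n - 1 then int n else 1))"
  let ?K = "\<lambda>k j. ones_basis_mat n $$ (k, j)"
  have K: "ones_basis_mat n = mat n n (\<lambda>(k, j). ?K k j)"
    by (rule eq_matI) (auto simp: ones_basis_mat_def)
  have "?L * ones_basis_mat n = mat n n (\<lambda>(i, j).
      (if i = n - 1 then \<Sum>k<n. ?K k j else ?K i j)
      - (if i = 0 then 0 else if i = n - 1 then int n else 1) * ?K 0 j)"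
    (is "_ = mat n n ?R")
  proof (subst K, unfold mat_times_mat, rule eq_matI, goal_cases)
    case (1 i j)
    then have ij: "i < n" "j < n" by auto
    have at: "(\<Sum>k<n. of_bool (k = l) * y * ?K k j) = y * ?K l j" if "l < n" for l y
    proof -
      have "(\<Sum>k<n. of_bool (k = l) * y * ?K k j) = (\<Sum>k\<in>{l}. of_bool (k = l) * y * ?K k j)"
        using that by (intro sum.mono_neutral_right) auto
      then show ?thesis by simp
    qed
    have "(\<Sum>k<n. of_bool (i = n - 1 \<or> i = k) * ?K k j) = (if i = n - 1 then \<Sum>k<n. ?K k j else ?K i j)"
      using at[OF ij(1), of 1] by (auto simp: eq_commute[of i])
    with at[of 0] n ij show ?case
      by (simp add: left_diff_distrib sum_subtractf)
  qed auto
  also have "\<dots> = 1\<^sub>m n"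
    using n by (intro eq_matI) (auto simp: column_sum_ones_basis_mat, auto simp: ones_basis_mat_def)
  finally show "?L * ones_basis_mat n = 1\<^sub>m n" .
qed simp

text \<open>The all-ones vector is fixed by \<open>stride_mat\<close> and is an eigenvector of
  \<open>M\<close> with eigenvalue na + sd. The product of both matrices scales the middle basis
  vectors by d and sends the last one to d times itself plus ua + qd times the all-ones
  vector.\<close>

lemma circulant_reduction:
  fixes a d :: int
  assumes n: "2 \<le> n" and su: "s * u = q * n + 1"
  defines "M \<equiv> mat n n (\<lambda>(i, j). d * residue_count n (int i - int j) s + a)"
  shows "M * stride_mat n s u * ones_basis_mat n = ones_basis_mat n *
    corner_mat n d (int n * a + int s * d) (int u * a + int q * d) 0 d"
proof -
  let ?\<sigma> = "int n * a + int s * d" and ?c = "int u * a + int q * d"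
  let ?K = "\<lambda>k j. ones_basis_mat n $$ (k, j)"
  have n0: "0 < n" using n by simp
  have K: "ones_basis_mat n = mat n n (\<lambda>(k, j). ?K k j)"
    by (rule eq_matI) (auto simp: ones_basis_mat_def)
  have su': "int u * int s = int q * int n + 1"
    using arg_cong[OF su, of int] by (simp add: mult.commute)
  \<comment> \<open>The uncorrected circulant gives dI plus \<open>?c\<close> times the all-ones
    matrix; the corrected column adds \<open>M\<close> applied to 1-u times the all-ones
    vector.\<close>
  have MV: "M * stride_mat n s u = mat n n (\<lambda>(i, j).
      d * of_bool (i = j) + (?c + (1 - int u) * of_bool (j = 0) * ?\<sigma>))"
    unfolding M_def stride_mat_def mat_times_mat
  proof (rule eq_matI, goal_cases)
    case (1 i j)
    then show ?case
      using int_dvd_diff_less_iff[of i n j]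
      by (simp only: dim_row_mat dim_col_mat index_mat split affine_convolution[OF n0 su])
         (simp add: algebra_simps)
  qed auto
  have "M * stride_mat n s u * ones_basis_mat n = mat n n (\<lambda>(i, j).
      d * ?K i j + (?c * (\<Sum>k<n. ?K k j) + (1 - int u) * ?\<sigma> * ?K 0 j))"
  proof (unfold MV, subst (1) K, unfold mat_times_mat, rule eq_matI, goal_cases)
    case (1 i j)
    then have ij: "i < n" "j < n" by auto
    have at: "(\<Sum>k<n. of_bool (k = l) * y * ?K k j) = y * ?K l j" if "l < n" for l y
    proof -
      have "(\<Sum>k<n. of_bool (k = l) * y * ?K k j) = (\<Sum>k\<in>{l}. of_bool (k = l) * y * ?K k j)"
        using that by (intro sum.mono_neutral_right) auto
      then show ?thesis by simp
    qed
    have "(\<Sum>k<n. (d * of_bool (i = k) + (?c + (1 - int u) * of_bool (k = 0) * ?\<sigma>)) * ?K k j)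
        = (\<Sum>k<n. of_bool (k = i) * d * ?K k j) + ?c * (\<Sum>k<n. ?K k j)
          + (\<Sum>k<n. of_bool (k = 0) * ((1 - int u) * ?\<sigma>) * ?K k j)"
      unfolding sum_distrib_left sum.distrib[symmetric]
      by (intro sum.cong refl) (simp add: algebra_simps eq_commute[of i])
    then show ?case
      using ij n0 by (simp add: at)
  qed auto
  also have "\<dots> = mat n n (\<lambda>(i, j).
     if j = 0 then ?K i 0 * ?\<sigma> + ?K i (n - 1) * 0
     else if j = n - 1 then ?K i 0 * ?c + ?K i (n - 1) * d
     else ?K i j * d)"
  proof (rule eq_matI, goal_cases)
    case (1 i j)
    then have ij: "i < n" "j < n" by auto
    have "d + int n * ?c + (1 - int u) * ?\<sigma>
        = ?\<sigma> + d * (1 + int q * int n - int u * int s)"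
      by (simp add: algebra_simps)
    then have "d + int n * ?c + (1 - int u) * ?\<sigma> = ?\<sigma>"
      using su' by simp
    then show ?case
      unfolding dim_row_mat dim_col_mat index_mat(1)[OF ij] split column_sum_ones_basis_mat[OF n ij(2)]
      using ij n by (auto simp: ones_basis_mat_def algebra_simps)
  qed auto
  also have "\<dots> = mat n n (\<lambda>(i, j). ?K i j) * corner_mat n d ?\<sigma> ?c 0 d"
    by (simp only: mat_times_corner_mat[OF n] split)
  finally show ?thesis
    unfolding K[symmetric] .
qed

section \<open>Diagonalization of the 2x2 block\<close>

text \<open>Adding n - m times the top row (a, d) makes the bottom row a multiple of (y, -x), which
  the Bezout column (x, y) annihilates; the column (-d', a') annihilates the top row. The factors
  \<open>\<delta>\<close> and \<open>e\<close> are left free for adjusting signs.\<close>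

lemma corner_mat_smith_form:
  fixes a d x y e \<delta> :: int
  assumes n: "2 \<le> n" and su: "s * u = q * n + 1"
    and g: "x * a + y * d = g" and a: "a = g * a'" and d: "d = g * d'" and "g \<noteq> 0"
  defines "m \<equiv> (int n * a' + int s * d') * x"
  shows "corner_mat n \<delta> 1 0 (e * (int n - m)) e
      * corner_mat n d (int n * a + int s * d) (int u * a + int q * d) 0 d
      * corner_mat n 1 (- int q) (int u) (int s) (- int n) * corner_mat n 1 x (- d') y a'
    = corner_mat n (\<delta> * d) g 0 0 (- e * (int n * a' + int s * d') * d)"
proof -
  have su': "int u * int s = int q * int n + 1"
    using arg_cong[OF su, of int] by (simp add: mult.commute)
  have "g * (x * a' + y * d') = g"
    using g a d by (simp add: algebra_simps)
  then have xy: "x * a' + y * d' = 1"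
    using \<open>g \<noteq> 0\<close> by simp
  have 1: "(int n * a + int s * d) * - int q + (int u * a + int q * d) * int s
      = a * (int u * int s - int q * int n)"
    by (simp add: algebra_simps)
  have 2: "(int n * a + int s * d) * int u + (int u * a + int q * d) * - int n
      = d * (int u * int s - int q * int n)"
    by (simp add: algebra_simps)
  \<comment> \<open>The second factor is minus the adjugate of [[n, u], [s, q]], whose determinant
    is -1, so the top row becomes (a, d).\<close>
  have E: "corner_mat n d (int n * a + int s * d) (int u * a + int q * d) 0 d
      * corner_mat n 1 (- int q) (int u) (int s) (- int n)
    = corner_mat n d a d (d * int s) (- d * int n)"
    using 1 2 su' by (simp add: corner_mat_mult[OF n])
  define \<sigma> where "\<sigma> = int n * a' + int s * d'"
  have m: "m = \<sigma> * x"
    by (simp add: m_def \<sigma>_def)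
  have "e * (int n - m) * a + e * (d * int s) = e * \<sigma> * g * (1 - x * a')"
    unfolding m by (simp add: a d \<sigma>_def algebra_simps)
  also have "1 - x * a' = y * d'"
    using xy by simp
  finally have 3: "e * (int n - m) * a + e * (d * int s) = e * \<sigma> * y * d"
    by (simp add: d)
  have 4: "e * (int n - m) * d + e * (- d * int n) = - e * \<sigma> * x * d"
    unfolding m by (simp add: algebra_simps)
  have U: "corner_mat n \<delta> 1 0 (e * (int n - m)) e * corner_mat n d a d (d * int s) (- d * int n)
    = corner_mat n (\<delta> * d) a d (e * \<sigma> * y * d) (- e * \<sigma> * x * d)"
    using 3 4 by (simp add: corner_mat_mult[OF n])
  have 5: "a * x + d * y = g" "a * - d' + d * a' = 0"
    "e * \<sigma> * y * d * x + - e * \<sigma> * x * d * y = 0"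
    using g by (simp_all add: a d algebra_simps)
  have "e * \<sigma> * y * d * - d' + - e * \<sigma> * x * d * a' = - e * \<sigma> * d * (x * a' + y * d')"
    by (simp add: algebra_simps)
  then have 6: "e * \<sigma> * y * d * - d' + - e * \<sigma> * x * d * a' = - e * \<sigma> * d"
    using xy by simp
  have R: "corner_mat n (\<delta> * d) a d (e * \<sigma> * y * d) (- e * \<sigma> * x * d) * corner_mat n 1 x (- d') y a'
    = corner_mat n (\<delta> * d) g 0 0 (- e * \<sigma> * d)"
    unfolding corner_mat_mult[OF n] 5 6 by simp
  show ?thesis
    by (subst assoc_mult_mat[of _ n n _ n _ n]) (simp_all only: corner_mat_carrier E U R \<sigma>_def[symmetric])
qed

theorem theorem4p5:
  fixes n s :: nat and a b k :: int and f g :: "int poly"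
  assumes "1 \<le> s" and "s < n" and "gcd n s = 1"
    and "\<not> (a = 0 \<and> b = 0)"
    and "g = monom 1 n - 1"
    and "f = smult b (\<Sum>i = 0..<s. monom 1 i) + smult a (\<Sum>i = s..<n. monom 1 i)"
    and "k = \<bar>a * (int n - int s) + int s * b\<bar> div gcd a b"
  shows "are_invariant_factors (poly_mat f (companion_mat g))
           ([gcd a b] @ replicate (n - 2) \<bar>a - b\<bar> @ [k * \<bar>a - b\<bar>])"
proof -
  define d where "d = b - a"
  define h where "h = gcd a b"
  define M where "M = mat n n (\<lambda>(i, j). d * residue_count n (int i - int j) s + a)"
  have n: "2 \<le> n" using assms(1,2) by simp
  have h: "h > 0" "h = gcd a d"
    using assms(4) by (simp_all add: h_def d_def) (metis gcd.commute gcd_diff1)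
  \<comment> \<open>Bezout over the naturals: \<open>u\<close> has to count summands and
    \<open>q\<close> full periods.\<close>
  obtain u q where su: "s * u = q * n + 1"
    using bezout_nat[of s n] assms(1,3) by (auto simp: gcd.commute mult.commute)
  obtain x y where xy: "x * a + y * d = h"
    using bezout_int[of a d] h by auto
  obtain a' d' where a': "a = h * a'" and d': "d = h * d'"
    using h by (metis dvdE gcd_dvd1 gcd_dvd2)
  define \<sigma> where "\<sigma> = int n * a' + int s * d'"
  have "a * (int n - int s) + int s * b = h * \<sigma>"
    using a' d' by (simp add: \<sigma>_def d_def algebra_simps)
  then have k: "k = \<bar>\<sigma>\<bar>"
    using assms(7) h(1) unfolding h_def[symmetric] by (simp add: abs_mult)
  \<comment> \<open>Signs that make the diagonal non-negative. At zero they are set to 1, so they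
    remain units even when a = b or k = 0.\<close>
  define e where "e = (if \<sigma> * d \<le> 0 then 1 else - 1 :: int)"
  define \<delta> where "\<delta> = (if d \<ge> 0 then 1 else - 1 :: int)"
  define U where "U = corner_mat n \<delta> 1 0 (e * (int n - \<sigma> * x)) e"
  define E where "E = corner_mat n d (int n * a + int s * d) (int u * a + int q * d) 0 d"
  define Q where "Q = corner_mat n 1 (- int q) (int u) (int s) (- int n)"
  define R where "R = corner_mat n 1 x (- d') y a'"
  define S where "S = corner_mat n \<bar>d\<bar> h 0 0 (k * \<bar>d\<bar>)"
  define V where "V = stride_mat n s u"
  define K where "K = ones_basis_mat n"
  obtain L where L: "L \<in> carrier_mat n n" "L * K = 1\<^sub>m n"
    using ones_basis_mat_left_inverse[OF n] unfolding K_def .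
  have carrier: "M \<in> carrier_mat n n" "U \<in> carrier_mat n n" "E \<in> carrier_mat n n"
    "Q \<in> carrier_mat n n" "R \<in> carrier_mat n n" "V \<in> carrier_mat n n" "K \<in> carrier_mat n n"
    by (simp_all add: M_def U_def E_def Q_def R_def V_def K_def stride_mat_def ones_basis_mat_def)
  have "h * (x * a' + y * d') = h"
    using xy a' d' by (simp add: algebra_simps)
  then have "x * a' - - d' * y = 1"
    using h(1) by (simp add: mult.commute)
  moreover have "- int q * - int n - int u * int s = - 1"
    using arg_cong[OF su, of int] by (simp add: algebra_simps)
  moreover have "e * e = 1" "\<delta> * \<delta> = 1"
    by (simp_all add: e_def \<delta>_def)
  ultimately have "invertible_mat U" "invertible_mat Q" "invertible_mat R"
    unfolding U_def Q_def R_def by (intro invertible_corner_mat[OF n]; simp)+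
  moreover have "invertible_mat L" "invertible_mat K"
    using invertible_matI_right_inverse[OF L(1) carrier(7) L(2)] .
  moreover have "invertible_mat V"
    unfolding V_def using n su by (intro invertible_stride_mat) auto
  ultimately have inv: "invertible_mat (U * L)" "invertible_mat (V * K * Q * R)"
    using carrier L(1) by (auto intro!: invertible_mat_mult[of _ n])
  \<comment> \<open>Regrouped so that M V K becomes K E and \<open>L\<close> cancels
    \<open>K\<close>, leaving a product of corner matrices.\<close>
  have "U * L * M * (V * K * Q * R) = U * (L * (M * V * K)) * Q * R"
    using carrier L(1) by (simp add: assoc_mult_mat[of _ n n _ n _ n])
  also have "L * (M * V * K) = L * K * E"
    using circulant_reduction[OF n su, of d a] carrier L(1)
    by (simp add: M_def V_def K_def E_def assoc_mult_mat[of _ n n _ n _ n])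
  also have "\<dots> = E"
    using L carrier by simp
  also have "U * E * Q * R = corner_mat n (\<delta> * d) h 0 0 (- e * \<sigma> * d)"
    unfolding U_def E_def Q_def R_def \<sigma>_def
    using corner_mat_smith_form[OF n su xy a' d'] h(1) by simp
  also have "\<dots> = S"
  proof -
    have "- e * \<sigma> * d = k * \<bar>d\<bar>"
      unfolding k abs_mult[symmetric] by (simp add: e_def)
    moreover have "\<delta> * d = \<bar>d\<bar>"
      by (simp add: \<delta>_def)
    ultimately show ?thesis
      unfolding S_def by (simp only:)
  qed
  finally have S: "S = U * L * M * (V * K * Q * R)" ..
  \<comment> \<open>This gives the whole divisibility chain, as each later entry is \<bar>d\<bar> or
    k\<bar>d\<bar>; for n = 2 only the latter occurs.\<close>
  have dvd: "h dvd d"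
    using d' by simp
  have "is_smith_form M S"
    unfolding is_smith_form_def
  proof (intro conjI)
    show "\<exists>n U V. M \<in> carrier_mat n n \<and> U \<in> carrier_mat n n \<and> V \<in> carrier_mat n n
        \<and> invertible_mat U \<and> invertible_mat V \<and> S = U * M * V"
      using S inv carrier L(1)
      by (intro exI[of _ n] exI[of _ "U * L"] exI[of _ "V * K * Q * R"]) auto
    show "diagonal_mat S"
      by (auto simp: S_def corner_mat_def diagonal_mat_def)
    show "\<forall>i<dim_row S. 0 \<le> S $$ (i, i)"
      using h k by (auto simp: S_def corner_mat_def)
    show "\<forall>i. i + 1 < dim_row S \<longrightarrow> S $$ (i, i) dvd S $$ (i + 1, i + 1)"
      using dvd n by (auto simp: S_def corner_mat_def)
  qed
  moreover have "[gcd a b] @ replicate (n - 2) \<bar>a - b\<bar> @ [k * \<bar>a - b\<bar>] = diag_mat S"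
  proof (rule nth_equalityI)
    fix i
    assume "i < length ([gcd a b] @ replicate (n - 2) \<bar>a - b\<bar> @ [k * \<bar>a - b\<bar>])"
    then have "i < n" using n by simp
    then show "([gcd a b] @ replicate (n - 2) \<bar>a - b\<bar> @ [k * \<bar>a - b\<bar>]) ! i = diag_mat S ! i"
      using n by (auto simp: diag_mat_def S_def corner_mat_def h_def d_def nth_append nth_Cons' abs_minus_commute)
  qed (use n in \<open>simp add: diag_mat_def S_def corner_mat_def\<close>)
  moreover have "poly_mat f (companion_mat g) = M"
    using poly_mat_two_coefficients[OF assms(1,2), of b a] assms(5,6) by (simp add: M_def d_def)
  ultimately show ?thesis
    unfolding are_invariant_factors_def by auto
qed

end
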